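(* Let $1\le k\le n-1$, let $A\subset\mathbb{R}$, let $T:A\times\mathcal{P}(\mathbb{R})\to\mathcal{P}(\mathbb{R})$ be differentiable with respect to its first argument, and let $F\in\mathcal{P}(\mathbb{R})$. Let $\psi$ be the generator of an $n$-dimensional Archimedean copula $C_\psi$; assume that $\psi$ is $d$-monotone with $d\ge k+3$ and that its inverse generator $\phi=\psi^{-1}$ is differentiable on the relevant interval. For $\boldsymbol{\alpha}=(\alpha_1,\ldots,\alpha_n)\in A^n$, let $X_{n-k:n}(\boldsymbol{\alpha})$ be the $(n-k)$-th order statistic of a random vector $(X_1,\ldots,X_n)$ with marginal distribution functions $F_{X_i}=T(\alpha_i,F)$ and copula $C_\psi$, and let $F_{n-k:n}^{(\boldsymbol{\alpha})}$ be its distribution function. 1. If $T$ is increasing in its first argument, that is, $\alpha\le\beta$ implies $T(\alpha,F)(x)\le T(\beta,F)(x)$ for every $x\in\mathbb{R}$, then for each fixed $x\in\mathbb{R}$ the map $\boldsymbol{\alpha}\mapsto F_{n-k:n}^{(\boldsymbol{\alpha})}(x)$ is increasing in each coordinate. 2. If $T$ is decreasing in its first argument, that is, $\alpha\le\beta$ implies $T(\alpha,F)(x)\ge T(\beta,F)(x)$ for every $x\in\mathbb{R}$, then for each fixed $x\in\mathbb{R}$ the same map is decreasing in each coordinate. Consequently, if $\boldsymbol{\alpha}=(\alpha_1,\ldots,\alpha_n)$ and $\boldsymbol{\beta}=(\beta_1,\ldots,\beta_n)$ in $A^n$ satisfy $\alpha_i\le\beta_i$ for every $i=1,\ldots,n$,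 then $X_{n-k:n}(\boldsymbol{\alpha})\ge_{st}X_{n-k:n}(\boldsymbol{\beta})$ if $T$ is increasing in its first argument, and $X_{n-k:n}(\boldsymbol{\alpha})\le_{st}X_{n-k:n}(\boldsymbol{\beta})$ if $T$ is decreasing in its first argument.
   Context: $\mathcal{P}(\mathbb{R})$ is the set of all cumulative distribution functions on $\mathbb{R}$. $X_{n-k:n}$ denotes the $(n-k)$-th smallest among $X_1,\ldots,X_n$. "Differentiable with respect to its first argument" refers to $\alpha\mapsto T(\alpha,F)(x)$, and the "relevant interval" for $\phi$ is the interval in which the arguments $T(\alpha_i,F)(x)\in(0,1)$, at which $\phi$ is evaluated, lie. For random variables, $X\le_{st}Y$ (equivalently $Y\ge_{st}X$) means $P(X>x)\le P(Y>x)$ for every $x\in\mathbb{R}$. "Increasing" and "decreasing" are meant in the non-strict sense. A function $f$ is $d$-monotone ($d\ge2$) on $(a,b)$ if it is differentiable up to order $d-2$ there, $(-1)^if^{(i)}\ge0$ for $i=0,\ldots,d-2$, and $(-1)^{d-2}f^{(d-2)}$ is nonincreasing and convex on $(a,b)$. A generator is a continuous $d$-monotone function $\psi:[0,\infty)\to[0,1]$ with $\psi(0)=1$ and $\lim_{x\to\infty}\psi(x)=0$; its inverse is $\phi(v)=\psi^{-1}(v)=\sup\{x:\psi(x)>v\}$. An $n$-dimensional copula $C_\psi$ is Archimedean with generator $\psi$ if $C_\psi(v_1,\ldots,v_n)=\psi(\phi(v_1)+\cdots+\phi(v_n))$ for all $v_i\in[0,1]$. A random vector $(X_1,\ldots,X_n)$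 has copula $C$ if $P(X_1\le x_1,\ldots,X_n\le x_n)=C(F_{X_1}(x_1),\ldots,F_{X_n}(x_n))$ for all $x_1,\dots,x_n\in\mathbb{R}$. *)

theory Defs
  imports "HOL-Probability.Probability"
begin

definition cdfs :: "(real \<Rightarrow> real) set" where
  "cdfs = {cdf \<mu> | \<mu>. real_distribution \<mu>}"

(* Points of R^n are functions on the index set {1..n}, as elements of {1..n} \<rightarrow>\<^sub>E A. *)

abbreviation dist_fun :: "'a measure \<Rightarrow> ('a \<Rightarrow> real) \<Rightarrow> real \<Rightarrow> real" where
  "dist_fun M Y \<equiv> cdf (distr M borel Y)"

(* The j-th smallest of x 1, ..., x n, for 1 \<le> j \<le> n. *)
definition order_stat :: "nat \<Rightarrow> nat \<Rightarrow> (nat \<Rightarrow> real) \<Rightarrow> real" where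
  "order_stat n j x = sort (map x [1..<Suc n]) ! (j - 1)"

definition st_le :: "'a measure \<Rightarrow> ('a \<Rightarrow> real) \<Rightarrow> 'b measure \<Rightarrow> ('b \<Rightarrow> real) \<Rightarrow> bool" where
  "st_le M Y N Z \<longleftrightarrow>
     (\<forall>x. measure M {\<omega> \<in> space M. Y \<omega> > x} \<le> measure N {\<omega> \<in> space N. Z \<omega> > x})"

definition d_monotone_on :: "nat \<Rightarrow> (real \<Rightarrow> real) \<Rightarrow> real set \<Rightarrow> bool" where
  "d_monotone_on d f I \<longleftrightarrow> 2 \<le> d \<and>
     (\<forall>i < d - 2. \<forall>x \<in> I. (deriv ^^ i) f differentiable (at x)) \<and>
     (\<forall>i \<le> d - 2. \<forall>x \<in> I. 0 \<le> (-1) ^ i * (deriv ^^ i) f x) \<and>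
     antimono_on I (\<lambda>x. (-1) ^ (d - 2) * (deriv ^^ (d - 2)) f x) \<and>
     convex_on I (\<lambda>x. (-1) ^ (d - 2) * (deriv ^^ (d - 2)) f x)"

(* d-monotonicity is a notion for open intervals, so it is required on the interior (0, \<infinity>);
   continuity at 0 is a separate clause. Values of \<psi> on negative reals are irrelevant. *)
definition generator :: "nat \<Rightarrow> (real \<Rightarrow> real) \<Rightarrow> bool" where
  "generator d \<psi> \<longleftrightarrow>
     \<psi> ` {0..} \<subseteq> {0..1} \<and> continuous_on {0..} \<psi> \<and> d_monotone_on d \<psi> {0<..} \<and>
     \<psi> 0 = 1 \<and> (\<psi> \<longlongrightarrow> 0) at_top"

(* The supremum is taken in [0, \<infinity>], so that it is 0 for v = 1 (empty set) and may be \<infinity> for v = 0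
   (when \<psi> never vanishes). *)
definition inverse_generator :: "(real \<Rightarrow> real) \<Rightarrow> real \<Rightarrow> ennreal" where
  "inverse_generator \<psi> v = (SUP x \<in> {x. 0 \<le> x \<and> \<psi> x > v}. ennreal x)"

(* \<psi> extended by its limit \<psi>(\<infinity>) = 0. *)
definition extended_generator :: "(real \<Rightarrow> real) \<Rightarrow> ennreal \<Rightarrow> real" where
  "extended_generator \<psi> t = (if t = \<infinity> then 0 else \<psi> (enn2real t))"

definition archimedean :: "nat \<Rightarrow> (real \<Rightarrow> real) \<Rightarrow> (nat \<Rightarrow> real) \<Rightarrow> real" where
  "archimedean n \<psi> v = extended_generator \<psi> (\<Sum>i = 1..n. inverse_generator \<psi> (v i))"

(* An n-dimensional copula is (the restriction to [0,1]^n of) a joint distribution function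
   on R^n all of whose univariate margins are uniform on [0,1]. *)
definition copula :: "nat \<Rightarrow> ((nat \<Rightarrow> real) \<Rightarrow> real) \<Rightarrow> bool" where
  "copula n C \<longleftrightarrow>
     (\<exists>\<mu>. prob_space \<mu> \<and> sets \<mu> = sets (\<Pi>\<^sub>M i\<in>{1..n}. (borel :: real measure)) \<and>
       (\<forall>i\<in>{1..n}. distr \<mu> borel (\<lambda>u. u i) = uniform_measure lborel {0..1}) \<and>
       (\<forall>v \<in> {1..n} \<rightarrow>\<^sub>E {0..1}. C v = measure \<mu> {u \<in> space \<mu>. \<forall>i\<in>{1..n}. u i \<le> v i}))"

definition has_copula ::
  "'a measure \<Rightarrow> nat \<Rightarrow> (nat \<Rightarrow> 'a \<Rightarrow> real) \<Rightarrow> ((nat \<Rightarrow> real) \<Rightarrow> real) \<Rightarrow> bool" where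
  "has_copula M n X C \<longleftrightarrow>
     (\<forall>x :: nat \<Rightarrow> real. measure M {\<omega> \<in> space M. \<forall>i\<in>{1..n}. X i \<omega> \<le> x i}
        = C (\<lambda>i\<in>{1..n}. dist_fun M (X i) (x i)))"

definition increasing_each_coord ::
  "nat \<Rightarrow> real set \<Rightarrow> ((nat \<Rightarrow> real) \<Rightarrow> real) \<Rightarrow> bool" where
  "increasing_each_coord n A g \<longleftrightarrow>
     (\<forall>\<alpha> \<in> {1..n} \<rightarrow>\<^sub>E A. \<forall>i\<in>{1..n}. mono_on A (\<lambda>t. g (\<alpha>(i := t))))"

definition decreasing_each_coord ::
  "nat \<Rightarrow> real set \<Rightarrow> ((nat \<Rightarrow> real) \<Rightarrow> real) \<Rightarrow> bool" where
  "decreasing_each_coord n A g \<longleftrightarrow>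
     (\<forall>\<alpha> \<in> {1..n} \<rightarrow>\<^sub>E A. \<forall>i\<in>{1..n}. antimono_on A (\<lambda>t. g (\<alpha>(i := t))))"

(* The smallest interval containing all values T(\<alpha>,F)(x) that lie in (0,1), with \<alpha> in A and x real. *)
definition relevant_interval ::
  "real set \<Rightarrow> (real \<Rightarrow> (real \<Rightarrow> real) \<Rightarrow> real \<Rightarrow> real) \<Rightarrow> (real \<Rightarrow> real) \<Rightarrow> real set" where
  "relevant_interval A T F = convex hull ({T \<alpha> F x | \<alpha> x. \<alpha> \<in> A} \<inter> {0<..<1})"

end

theory Submission
  imports Defs
begin

text \<open>
  Let \<open>\<mu>\<close> be the law on the unit cube whose distribution function is the copula. Inclusion-exclusion
  shows that the random set of indices \<open>i\<close> with \<open>X i \<le> x\<close> has the same law as the random set of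
  indices with \<open>U i \<le> T (\<alpha> i) F x\<close>, where \<open>U\<close> has law \<open>\<mu>\<close>. The event that the latter set has at
  least \<open>n - k\<close> elements, taken on the one space \<open>\<mu>\<close> for all \<open>\<alpha>\<close> simultaneously, grows with each
  threshold \<open>T (\<alpha> i) F x\<close>.
\<close>

section \<open>Order statistics through counting\<close>

text \<open>In a sorted list the entries not exceeding \<open>t\<close> occupy an initial segment of
  positions. Position \<open>m\<close>, counted from 0, lies in that segment exactly when its length
  is at least \<open>m + 1\<close>.\<close>

lemma sorted_nth_le_iff:
  fixes xs :: "'a::linorder list"
  assumes "sorted xs" "m < length xs"
  shows "xs ! m \<le> t \<longleftrightarrow> m < length (filter (\<lambda>y. y \<le> t) xs)"
proof -
  let ?B = "{i. i < length xs \<and> xs ! i \<le> t}"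
  have len: "length (filter (\<lambda>y. y \<le> t) xs) = card ?B"
    by (simp add: length_filter_conv_card)
  show ?thesis
  proof
    assume "xs ! m \<le> t"
    then have "{..m} \<subseteq> ?B"
      using assms by (auto intro: order_trans[OF sorted_nth_mono])
    then have "card {..m} \<le> card ?B"
      by (intro card_mono) auto
    then show "m < length (filter (\<lambda>y. y \<le> t) xs)"
      using len by simp
  next
    assume less: "m < length (filter (\<lambda>y. y \<le> t) xs)"
    show "xs ! m \<le> t"
    proof (rule ccontr)
      assume "\<not> xs ! m \<le> t"
      then have "i < m" if "i \<in> ?B" for i
        using that sorted_nth_mono[OF assms(1), of m i] by (force simp: not_less)
      then have "?B \<subseteq> {..<m}"
        by blast
      then have "card ?B \<le> card {..<m}"
        by (intro card_mono) auto
      then show False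
        using less len by simp
    qed
  qed
qed

text \<open>Sorting preserves the number of entries below a threshold, so events about order
  statistics become events about the index set \<open>{i \<in> {1..n}. x i \<le> t}\<close>. The
  position \<open>j - 1\<close>, counted from 0, turns the strict bound on the count into
  \<open>j \<le>\<close>.\<close>

lemma order_stat_le_iff:
  assumes "1 \<le> j" "j \<le> n"
  shows "order_stat n j x \<le> t \<longleftrightarrow> j \<le> card {i \<in> {1..n}. x i \<le> t}"
proof -
  let ?xs = "map x [1..<Suc n]"
  have "length (filter (\<lambda>y. y \<le> t) (sort ?xs)) = length (filter (\<lambda>y. y \<le> t) ?xs)"
    by (metis filter_sort length_sort)
  also have "\<dots> = length (filter (\<lambda>i. x i \<le> t) [1..<Suc n])"
    by (simp add: filter_map o_def del: upt_Suc)
  also have "\<dots> = card ({i. x i \<le> t} \<inter> set [1..<Suc n])"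
    by (rule distinct_length_filter) simp
  also have "{i. x i \<le> t} \<inter> set [1..<Suc n] = {i \<in> {1..n}. x i \<le> t}"
    by auto
  finally have "length (filter (\<lambda>y. y \<le> t) (sort ?xs)) = card {i \<in> {1..n}. x i \<le> t}" .
  then show ?thesis
    using assms sorted_nth_le_iff[of "sort ?xs" "j - 1" t] unfolding order_stat_def by auto
qed

section \<open>Patterns of a finite random set of indices\<close>

text \<open>Splitting by the exact value \<open>S\<close> of the random index set reduces any event
  about that set to atoms; for finite \<open>I\<close> there are finitely many. Both measurability
  and probabilities are computed through this decomposition.\<close>

lemma Collect_pattern_eq_Union:
  "{\<omega> \<in> W. Q {i \<in> I. P i \<omega>}} =
     (\<Union>S \<in> {S \<in> Pow I. Q S}. {\<omega> \<in> W. (\<forall>i\<in>S. P i \<omega>) \<and> (\<forall>i\<in>I - S. \<not> P i \<omega>)})"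
proof (intro equalityI subsetI)
  fix \<omega> assume "\<omega> \<in> {\<omega> \<in> W. Q {i \<in> I. P i \<omega>}}"
  then show "\<omega> \<in> (\<Union>S \<in> {S \<in> Pow I. Q S}. {\<omega> \<in> W. (\<forall>i\<in>S. P i \<omega>) \<and> (\<forall>i\<in>I - S. \<not> P i \<omega>)})"
    by (intro UN_I[of "{i \<in> I. P i \<omega>}"]) auto
next
  fix \<omega> assume "\<omega> \<in> (\<Union>S \<in> {S \<in> Pow I. Q S}. {\<omega> \<in> W. (\<forall>i\<in>S. P i \<omega>) \<and> (\<forall>i\<in>I - S. \<not> P i \<omega>)})"
  then obtain S where "\<omega> \<in> W" "S \<subseteq> I" "Q S" "\<forall>i\<in>S. P i \<omega>" "\<forall>i\<in>I - S. \<not> P i \<omega>"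
    by blast
  moreover from this have "{i \<in> I. P i \<omega>} = S"
    by blast
  ultimately show "\<omega> \<in> {\<omega> \<in> W. Q {i \<in> I. P i \<omega>}}"
    by simp
qed

lemma sets_pattern:
  assumes fin: "finite I" and meas: "\<And>i. i \<in> I \<Longrightarrow> Measurable.pred M (P i)"
    and "S \<subseteq> I" "R \<subseteq> I"
  shows "{\<omega> \<in> space M. (\<forall>i\<in>S. P i \<omega>) \<and> (\<forall>i\<in>R. \<not> P i \<omega>)} \<in> sets M"
proof -
  have [measurable]: "\<And>i. i \<in> S \<Longrightarrow> Measurable.pred M (P i)" "\<And>i. i \<in> R \<Longrightarrow> Measurable.pred M (P i)"
    using assms by auto
  have [simp]: "countable S" "countable R"
    using assms finite_subset countable_finite by blast+
  show ?thesis
    by measurable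
qed

lemma sets_Collect_pattern:
  assumes "finite I" "\<And>i. i \<in> I \<Longrightarrow> Measurable.pred M (P i)"
  shows "{\<omega> \<in> space M. Q {i \<in> I. P i \<omega>}} \<in> sets M"
  unfolding Collect_pattern_eq_Union
  using assms by (intro sets.finite_UN sets_pattern) auto

text \<open>One step of inclusion-exclusion: forbidding \<open>r\<close> removes the outcomes in
  which \<open>r\<close> occurs. The sets \<open>S\<close> and \<open>R\<close> need not be
  complementary, so the step can be iterated.\<close>

lemma (in finite_measure) measure_pattern_insert:
  assumes fin: "finite I" and P: "\<And>i. i \<in> I \<Longrightarrow> Measurable.pred M (P i)"
    and "r \<in> I" "R \<subseteq> I" "S \<subseteq> I"
  shows "measure M {\<omega> \<in> space M. (\<forall>i\<in>S. P i \<omega>) \<and> (\<forall>i\<in>insert r R. \<not> P i \<omega>)} =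
    measure M {\<omega> \<in> space M. (\<forall>i\<in>S. P i \<omega>) \<and> (\<forall>i\<in>R. \<not> P i \<omega>)} -
    measure M {\<omega> \<in> space M. (\<forall>i\<in>insert r S. P i \<omega>) \<and> (\<forall>i\<in>R. \<not> P i \<omega>)}"
proof -
  let ?Z = "\<lambda>S R. {\<omega> \<in> space M. (\<forall>i\<in>S. P i \<omega>) \<and> (\<forall>i\<in>R. \<not> P i \<omega>)}"
  have "measure M (?Z S R - ?Z (insert r S) R) = measure M (?Z S R) - measure M (?Z (insert r S) R)"
    using assms by (intro finite_measure_Diff sets_pattern) auto
  moreover have "?Z S R - ?Z (insert r S) R = ?Z S (insert r R)"
    by auto
  ultimately show ?thesis
    by simp
qed

text \<open>Atoms for distinct \<open>S\<close> are disjoint, since some index is required in one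
  and forbidden in the other; finite additivity then applies.\<close>

lemma (in finite_measure) measure_Collect_pattern:
  assumes fin: "finite I" and P: "\<And>i. i \<in> I \<Longrightarrow> Measurable.pred M (P i)"
  shows "measure M {\<omega> \<in> space M. Q {i \<in> I. P i \<omega>}} =
    (\<Sum>S \<in> {S \<in> Pow I. Q S}. measure M {\<omega> \<in> space M. (\<forall>i\<in>S. P i \<omega>) \<and> (\<forall>i\<in>I - S. \<not> P i \<omega>)})"
proof -
  have "{\<omega> \<in> space M. (\<forall>i\<in>S. P i \<omega>) \<and> (\<forall>i\<in>I - S. \<not> P i \<omega>)} \<inter>
      {\<omega> \<in> space M. (\<forall>i\<in>S'. P i \<omega>) \<and> (\<forall>i\<in>I - S'. \<not> P i \<omega>)} = {}"
    if "S \<subseteq> I" "S' \<subseteq> I" "S \<noteq> S'" for S S'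
    using that by blast
  then show ?thesis
    unfolding Collect_pattern_eq_Union using assms
    by (intro finite_measure_finite_Union image_subsetI sets_pattern)
       (auto simp: disjoint_family_on_def)
qed

text \<open>Removing the forbidden indices one at a time expresses each pattern probability through
  probabilities with requirements only, and those agree by assumption.\<close>

lemma measure_pattern_eq:
  assumes M: "finite_measure M" and N: "finite_measure N" and fin: "finite I"
    and P: "\<And>i. i \<in> I \<Longrightarrow> Measurable.pred M (P i)"
    and P': "\<And>i. i \<in> I \<Longrightarrow> Measurable.pred N (P' i)"
    and eq: "\<And>S. S \<subseteq> I \<Longrightarrow>
      measure M {\<omega> \<in> space M. \<forall>i\<in>S. P i \<omega>} = measure N {\<omega> \<in> space N. \<forall>i\<in>S. P' i \<omega>}"
    and SR: "S \<subseteq> I" "R \<subseteq> I"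
  shows "measure M {\<omega> \<in> space M. (\<forall>i\<in>S. P i \<omega>) \<and> (\<forall>i\<in>R. \<not> P i \<omega>)} =
    measure N {\<omega> \<in> space N. (\<forall>i\<in>S. P' i \<omega>) \<and> (\<forall>i\<in>R. \<not> P' i \<omega>)}"
proof -
  from fin SR(2) have "finite R"
    by (rule rev_finite_subset)
  then show ?thesis
    using SR
  \<comment> \<open>\<open>S\<close> must vary: inserting \<open>r\<close> into \<open>R\<close>
    uses the induction hypothesis at both \<open>S\<close> and \<open>insert r S\<close>.\<close>
  proof (induction R arbitrary: S rule: finite_induct)
    case empty
    then show ?case
      using eq by simp
  next
    case (insert r R)
    then show ?case
      using finite_measure.measure_pattern_insert[OF M fin, of P r R S] P
        finite_measure.measure_pattern_insert[OF N fin, of P' r R S] P'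
        insert.IH[of S] insert.IH[of "insert r S"] insert.prems by simp
  qed
qed

text \<open>The law of a random subset of a finite set is determined by the probabilities that it
  contains each given \<open>S\<close>. The two subsets may live on different spaces.\<close>

lemma measure_Collect_pattern_eq:
  assumes M: "finite_measure M" and N: "finite_measure N" and fin: "finite I"
    and P: "\<And>i. i \<in> I \<Longrightarrow> Measurable.pred M (P i)"
    and P': "\<And>i. i \<in> I \<Longrightarrow> Measurable.pred N (P' i)"
    and eq: "\<And>S. S \<subseteq> I \<Longrightarrow>
      measure M {\<omega> \<in> space M. \<forall>i\<in>S. P i \<omega>} = measure N {\<omega> \<in> space N. \<forall>i\<in>S. P' i \<omega>}"
  shows "measure M {\<omega> \<in> space M. Q {i \<in> I. P i \<omega>}} = measure N {\<omega> \<in> space N. Q {i \<in> I. P' i \<omega>}}"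
  using finite_measure.measure_Collect_pattern[OF M fin, of P Q] P
    finite_measure.measure_Collect_pattern[OF N fin, of P' Q] P'
  by (auto intro!: sum.cong measure_pattern_eq[OF M N fin P P' eq])

section \<open>Joint probabilities on subsets of the coordinates\<close>

text \<open>A union bound: an outcome satisfying the conditions on \<open>S\<close> but not all
  those on \<open>I\<close> must fail at some index of \<open>I - S\<close>. This controls the error
  made when a partial vector of thresholds is completed.\<close>

lemma (in prob_space) prob_Ball_diff_le:
  assumes fin: "finite I" and P: "\<And>i. i \<in> I \<Longrightarrow> Measurable.pred M (P i)" and "S \<subseteq> I"
  shows "\<bar>prob {\<omega> \<in> space M. \<forall>i\<in>S. P i \<omega>} - prob {\<omega> \<in> space M. \<forall>i\<in>I. P i \<omega>}\<bar>
    \<le> (\<Sum>i\<in>I - S. 1 - prob {\<omega> \<in> space M. P i \<omega>})"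
proof -
  let ?Z = "\<lambda>S. {\<omega> \<in> space M. \<forall>i\<in>S. P i \<omega>}"
  have meas: "?Z R \<in> events" if "R \<subseteq> I" for R
    using sets_pattern[OF fin P that, where R = "{}"] by simp
  have meas1: "{\<omega> \<in> space M. P i \<omega>} \<in> events" if "i \<in> I" for i
    using meas[of "{i}"] that by simp
  have "prob (?Z S) - prob (?Z I) = prob (?Z S - ?Z I)"
    using assms(3) meas by (intro finite_measure_Diff[symmetric]) auto
  also have "\<dots> \<le> prob (\<Union>i\<in>I - S. space M - {\<omega> \<in> space M. P i \<omega>})"
    using assms meas1 by (intro finite_measure_mono sets.finite_UN) auto
  also have "\<dots> \<le> (\<Sum>i\<in>I - S. prob (space M - {\<omega> \<in> space M. P i \<omega>}))"
    using fin meas1 by (intro finite_measure_subadditive_finite) auto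
  also have "\<dots> = (\<Sum>i\<in>I - S. 1 - prob {\<omega> \<in> space M. P i \<omega>})"
    using meas1 by (intro sum.cong refl prob_compl) auto
  finally have "prob (?Z S) - prob (?Z I) \<le> (\<Sum>i\<in>I - S. 1 - prob {\<omega> \<in> space M. P i \<omega>})" .
  moreover have "prob (?Z I) \<le> prob (?Z S)"
    using assms(3) meas by (intro finite_measure_mono) auto
  ultimately show ?thesis
    by simp
qed

lemma (in prob_space) dist_fun_eq_prob:
  assumes "random_variable borel Z"
  shows "dist_fun M Z x = prob {\<omega> \<in> space M. Z \<omega> \<le> x}"
proof -
  have "Z -` {..x} \<inter> space M = {\<omega> \<in> space M. Z \<omega> \<le> x}"
    by auto
  then show ?thesis
    using assms by (simp add: cdf_def measure_distr)
qed

text \<open>Only full vectors of thresholds enter \<^const>\<open>has_copula\<close>; a partial vector is the limit in which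
  the thresholds outside \<open>S\<close> tend to infinity.\<close>

lemma has_copula_Ball_eq:
  assumes M: "prob_space M" and N: "prob_space N"
    and X: "\<And>i. i \<in> {1..n} \<Longrightarrow> X i \<in> borel_measurable M"
    and U: "\<And>i. i \<in> {1..n} \<Longrightarrow> U i \<in> borel_measurable N"
    and unif: "\<And>i p. i \<in> {1..n} \<Longrightarrow> 0 \<le> p \<Longrightarrow> p \<le> 1 \<Longrightarrow> measure N {u \<in> space N. U i u \<le> p} = p"
    and C: "\<And>v. v \<in> {1..n} \<rightarrow>\<^sub>E {0..1} \<Longrightarrow> C v = measure N {u \<in> space N. \<forall>i\<in>{1..n}. U i u \<le> v i}"
    and cop: "has_copula M n X C" and S: "S \<subseteq> {1..n}"
  shows "measure M {\<omega> \<in> space M. \<forall>i\<in>S. X i \<omega> \<le> x} =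
    measure N {u \<in> space N. \<forall>i\<in>S. U i u \<le> dist_fun M (X i) x}"
proof -
  interpret M: prob_space M by fact
  interpret N: prob_space N by fact
  let ?F = "\<lambda>i. dist_fun M (X i)"
  \<comment> \<open>The threshold \<open>x\<close> is kept on \<open>S\<close>, while the other
    coordinates get a threshold that will tend to infinity. The levels \<open>p m i\<close> are the
    corresponding copula arguments; on \<open>S\<close> they do not depend on
    \<open>m\<close>.\<close>
  define y where "y m i = (if i \<in> S then x else real m)" for m i
  define p where "p m i = ?F i (y m i)" for m i
  have rd: "real_distribution (distr M borel (X i))" if "i \<in> {1..n}" for i
    using X[OF that] by (rule M.real_distribution_distr)
  \<comment> \<open>The assumptions \<open>unif\<close> and \<open>C\<close> speak only of levels in
    the unit interval.\<close>
  have p01: "0 \<le> p m i" "p m i \<le> 1" if "i \<in> {1..n}" for m i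
    unfolding p_def using rd[OF that] finite_borel_measure.cdf_nonneg[OF
      real_distribution.finite_borel_measure_M] real_distribution.cdf_bounded_prob by blast+
  have p_eq: "measure M {\<omega> \<in> space M. X i \<omega> \<le> y m i} = p m i" if "i \<in> {1..n}" for m i
    unfolding p_def using M.dist_fun_eq_prob[OF X[OF that]] by simp
  have joint: "measure M {\<omega> \<in> space M. \<forall>i\<in>{1..n}. X i \<omega> \<le> y m i} =
      measure N {u \<in> space N. \<forall>i\<in>{1..n}. U i u \<le> p m i}" for m
  proof -
    have "measure M {\<omega> \<in> space M. \<forall>i\<in>{1..n}. X i \<omega> \<le> y m i} = C (\<lambda>i\<in>{1..n}. p m i)"
      using cop unfolding has_copula_def p_def by blast
    also have "\<dots> = measure N {u \<in> space N. \<forall>i\<in>{1..n}. U i u \<le> (\<lambda>i\<in>{1..n}. p m i) i}"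
      using p01 by (intro C restrict_PiE_iff[THEN iffD2]) auto
    finally show ?thesis
      by (simp cong: rev_conj_cong)
  qed
  have predM: "Measurable.pred M (\<lambda>\<omega>. X i \<omega> \<le> c)" if "i \<in> {1..n}" for i c
    using X[OF that] by measurable
  have predN: "Measurable.pred N (\<lambda>u. U i u \<le> c)" if "i \<in> {1..n}" for i c
    using U[OF that] by measurable
  let ?a = "measure M {\<omega> \<in> space M. \<forall>i\<in>S. X i \<omega> \<le> x}"
  let ?b = "measure N {u \<in> space N. \<forall>i\<in>S. U i u \<le> ?F i x}"
  \<comment> \<open>Both partial probabilities are compared with the common full joint probability
    given by \<open>joint\<close>. The two errors have the same bound because the margins agree at
    the chosen levels, hence the factor 2.\<close>
  have bound: "\<bar>?a - ?b\<bar> \<le> 2 * (\<Sum>i\<in>{1..n} - S. 1 - ?F i (real m))" for m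
  proof -
    have "\<bar>?a - measure M {\<omega> \<in> space M. \<forall>i\<in>{1..n}. X i \<omega> \<le> y m i}\<bar>
        \<le> (\<Sum>i\<in>{1..n} - S. 1 - measure M {\<omega> \<in> space M. X i \<omega> \<le> y m i})"
      using M.prob_Ball_diff_le[of "{1..n}" "\<lambda>i \<omega>. X i \<omega> \<le> y m i" S] predM S
      by (simp add: y_def cong: rev_conj_cong)
    also have "\<dots> = (\<Sum>i\<in>{1..n} - S. 1 - p m i)"
      using p_eq by (intro sum.cong) auto
    finally have a: "\<bar>?a - measure M {\<omega> \<in> space M. \<forall>i\<in>{1..n}. X i \<omega> \<le> y m i}\<bar>
        \<le> (\<Sum>i\<in>{1..n} - S. 1 - p m i)" .
    have "{u \<in> space N. \<forall>i\<in>S. U i u \<le> ?F i x} = {u \<in> space N. \<forall>i\<in>S. U i u \<le> p m i}"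
      by (auto simp: p_def y_def)
    then have "\<bar>?b - measure N {u \<in> space N. \<forall>i\<in>{1..n}. U i u \<le> p m i}\<bar>
        \<le> (\<Sum>i\<in>{1..n} - S. 1 - measure N {u \<in> space N. U i u \<le> p m i})"
      using N.prob_Ball_diff_le[of "{1..n}" "\<lambda>i u. U i u \<le> p m i" S] predN S
      by simp
    also have "\<dots> = (\<Sum>i\<in>{1..n} - S. 1 - p m i)"
      using unif p01 by (intro sum.cong) auto
    finally have b: "\<bar>?b - measure N {u \<in> space N. \<forall>i\<in>{1..n}. U i u \<le> p m i}\<bar>
        \<le> (\<Sum>i\<in>{1..n} - S. 1 - p m i)" .
    have "(\<Sum>i\<in>{1..n} - S. 1 - p m i) = (\<Sum>i\<in>{1..n} - S. 1 - ?F i (real m))"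
      by (intro sum.cong) (auto simp: p_def y_def)
    then show ?thesis
      using a b unfolding joint by linarith
  qed
  have "(\<lambda>m. ?F i (real m)) \<longlonglongrightarrow> 1" if "i \<in> {1..n}" for i
    using real_distribution.cdf_lim_infty_prob[OF rd[OF that]] .
  \<comment> \<open>Each distribution function tends to 1, so the limit is a sum of terms
    \<open>1 - 1\<close>, that is, zero.\<close>
  then have "(\<lambda>m. 2 * (\<Sum>i\<in>{1..n} - S. 1 - ?F i (real m))) \<longlonglongrightarrow> 2 * (\<Sum>i\<in>{1..n} - S. 1 - 1)"
    by (intro tendsto_intros) auto
  then have "\<bar>?a - ?b\<bar> \<le> 2 * (\<Sum>i\<in>{1..n} - S. 1 - 1)"
    by (rule LIMSEQ_le_const) (use bound in auto)
  then show ?thesis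
    by simp
qed

section \<open>Distribution functions of order statistics under a common copula\<close>

lemma measure_uniform_atMost:
  assumes "0 \<le> p" "p \<le> (1::real)"
  shows "measure (uniform_measure lborel {0..1}) {..p} = p"
proof -
  have "{0..1} \<inter> {..p} = {0..p}"
    using assms by auto
  then show ?thesis
    using assms by (simp add: measure_uniform_measure)
qed

lemma measurable_order_stat:
  assumes "1 \<le> j" "j \<le> n" and X: "\<And>i. i \<in> {1..n} \<Longrightarrow> X i \<in> borel_measurable M"
  shows "(\<lambda>\<omega>. order_stat n j (\<lambda>i. X i \<omega>)) \<in> borel_measurable M"
proof -
  have pred: "Measurable.pred M (\<lambda>\<omega>. X i \<omega> \<le> c)" if "i \<in> {1..n}" for i c
    using X[OF that] by measurable
  have "{\<omega> \<in> space M. j \<le> card {i \<in> {1..n}. X i \<omega> \<le> c}} \<in> sets M" for c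
    using pred by (intro sets_Collect_pattern) auto
  then show ?thesis
    using assms by (simp add: borel_measurable_iff_le order_stat_le_iff)
qed

text \<open>The index sets on \<open>M\<close> and on \<open>N\<close> have equal containment
  probabilities, hence the same law, and the order statistic enters only through the size of the
  set. On the right, \<open>M\<close> and \<open>X\<close> survive only as the thresholds
  \<open>dist_fun M (X i) x\<close>.\<close>

lemma dist_fun_order_stat_eq:
  assumes j: "1 \<le> j" "j \<le> n" and M: "prob_space M" and N: "prob_space N"
    and X: "\<And>i. i \<in> {1..n} \<Longrightarrow> X i \<in> borel_measurable M"
    and U: "\<And>i. i \<in> {1..n} \<Longrightarrow> U i \<in> borel_measurable N"
    and unif: "\<And>i p. i \<in> {1..n} \<Longrightarrow> 0 \<le> p \<Longrightarrow> p \<le> 1 \<Longrightarrow> measure N {u \<in> space N. U i u \<le> p} = p"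
    and C: "\<And>v. v \<in> {1..n} \<rightarrow>\<^sub>E {0..1} \<Longrightarrow> C v = measure N {u \<in> space N. \<forall>i\<in>{1..n}. U i u \<le> v i}"
    and cop: "has_copula M n X C"
  shows "dist_fun M (\<lambda>\<omega>. order_stat n j (\<lambda>i. X i \<omega>)) x =
    measure N {u \<in> space N. j \<le> card {i \<in> {1..n}. U i u \<le> dist_fun M (X i) x}}"
proof -
  interpret M: prob_space M by fact
  interpret N: prob_space N by fact
  have predM: "Measurable.pred M (\<lambda>\<omega>. X i \<omega> \<le> c)" if "i \<in> {1..n}" for i c
    using X[OF that] by measurable
  have predN: "Measurable.pred N (\<lambda>u. U i u \<le> c)" if "i \<in> {1..n}" for i c
    using U[OF that] by measurable
  have "(\<lambda>\<omega>. order_stat n j (\<lambda>i. X i \<omega>)) \<in> borel_measurable M"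
    by (intro measurable_order_stat j X)
  then have "dist_fun M (\<lambda>\<omega>. order_stat n j (\<lambda>i. X i \<omega>)) x =
      M.prob {\<omega> \<in> space M. j \<le> card {i \<in> {1..n}. X i \<omega> \<le> x}}"
    by (simp add: M.dist_fun_eq_prob order_stat_le_iff[OF j])
  also have "\<dots> = N.prob {u \<in> space N. j \<le> card {i \<in> {1..n}. U i u \<le> dist_fun M (X i) x}}"
    by (intro measure_Collect_pattern_eq[where Q = "\<lambda>S. j \<le> card S"] predM predN
        has_copula_Ball_eq[OF M N X U unif C cop] M.finite_measure_axioms N.finite_measure_axioms) auto
  finally show ?thesis .
qed

text \<open>The two vectors may live on unrelated spaces, where their events cannot be compared
  directly. Both probabilities are therefore transferred to one space carrying the copula, where the
  comparison becomes inclusion of events.\<close>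

lemma dist_fun_order_stat_mono:
  assumes j: "1 \<le> j" "j \<le> n" and C: "copula n C"
    and M: "prob_space M" "\<And>i. i \<in> {1..n} \<Longrightarrow> X i \<in> borel_measurable M" "has_copula M n X C"
    and M': "prob_space M'" "\<And>i. i \<in> {1..n} \<Longrightarrow> X' i \<in> borel_measurable M'" "has_copula M' n X' C"
    and le: "\<And>i. i \<in> {1..n} \<Longrightarrow> dist_fun M (X i) x \<le> dist_fun M' (X' i) x"
  shows "dist_fun M (\<lambda>\<omega>. order_stat n j (\<lambda>i. X i \<omega>)) x
    \<le> dist_fun M' (\<lambda>\<omega>. order_stat n j (\<lambda>i. X' i \<omega>)) x"
proof -
  from C obtain \<mu> where \<mu>: "prob_space \<mu>"
      and sets: "sets \<mu> = sets (\<Pi>\<^sub>M i\<in>{1..n}. (borel :: real measure))"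
      and marg: "\<And>i. i \<in> {1..n} \<Longrightarrow> distr \<mu> borel (\<lambda>u. u i) = uniform_measure lborel {0..1}"
      and C\<mu>: "\<And>v. v \<in> {1..n} \<rightarrow>\<^sub>E {0..1} \<Longrightarrow>
        C v = measure \<mu> {u \<in> space \<mu>. \<forall>i\<in>{1..n}. u i \<le> v i}"
    unfolding copula_def by blast
  interpret \<mu>: prob_space \<mu> by fact
  have proj: "(\<lambda>u. u i) \<in> borel_measurable \<mu>" if "i \<in> {1..n}" for i
    unfolding measurable_cong_sets[OF sets refl] using that by (rule measurable_component_singleton)
  have unif: "\<mu>.prob {u \<in> space \<mu>. u i \<le> p} = p" if "i \<in> {1..n}" "0 \<le> p" "p \<le> 1" for i p
    using \<mu>.dist_fun_eq_prob[OF proj[OF that(1)], of p] marg[OF that(1)]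
      measure_uniform_atMost[OF that(2,3)] by (simp add: cdf_def)
  have pred\<mu>: "Measurable.pred \<mu> (\<lambda>u. u i \<le> c)" if "i \<in> {1..n}" for i c
    using proj[OF that] by measurable
  \<comment> \<open>For a fixed outcome \<open>u\<close>, raising the thresholds can only enlarge
    the set of indices counted.\<close>
  have "{u \<in> space \<mu>. j \<le> card {i \<in> {1..n}. u i \<le> dist_fun M (X i) x}} \<subseteq>
      {u \<in> space \<mu>. j \<le> card {i \<in> {1..n}. u i \<le> dist_fun M' (X' i) x}}"
    using le by (auto intro!: card_mono elim!: order_trans intro: order_trans)
  then have "\<mu>.prob {u \<in> space \<mu>. j \<le> card {i \<in> {1..n}. u i \<le> dist_fun M (X i) x}} \<le>
      \<mu>.prob {u \<in> space \<mu>. j \<le> card {i \<in> {1..n}. u i \<le> dist_fun M' (X' i) x}}"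
    using pred\<mu> by (intro \<mu>.finite_measure_mono sets_Collect_pattern) auto
  moreover have "dist_fun M (\<lambda>\<omega>. order_stat n j (\<lambda>i. X i \<omega>)) x =
      \<mu>.prob {u \<in> space \<mu>. j \<le> card {i \<in> {1..n}. u i \<le> dist_fun M (X i) x}}"
    by (intro dist_fun_order_stat_eq[where C = C] j M \<mu> proj unif C\<mu>)
  moreover have "dist_fun M' (\<lambda>\<omega>. order_stat n j (\<lambda>i. X' i \<omega>)) x =
      \<mu>.prob {u \<in> space \<mu>. j \<le> card {i \<in> {1..n}. u i \<le> dist_fun M' (X' i) x}}"
    by (intro dist_fun_order_stat_eq[where C = C] j M' \<mu> proj unif C\<mu>)
  ultimately show ?thesis
    by simp
qed

section \<open>Stochastic order and the comparison in the parameters\<close>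

text \<open>Survival probabilities are complements of distribution functions, so the inequality
  reverses: the variable with the larger distribution function is the stochastically smaller
  one.\<close>

lemma st_le_of_dist_fun:
  assumes "prob_space M" "Y \<in> borel_measurable M" "prob_space N" "Z \<in> borel_measurable N"
    and "\<And>x. dist_fun N Z x \<le> dist_fun M Y x"
  shows "st_le M Y N Z"
proof -
  have compl: "measure L {\<omega> \<in> space L. V \<omega> > x} = 1 - dist_fun L V x"
    if "prob_space L" and [measurable]: "V \<in> borel_measurable L" for L :: "'z measure" and V x
  proof -
    interpret L: prob_space L by fact
    have "{\<omega> \<in> space L. V \<omega> > x} = space L - {\<omega> \<in> space L. V \<omega> \<le> x}"
      by auto
    then show ?thesis
      using that(2) by (simp add: L.dist_fun_eq_prob L.prob_compl)
  qed
  show ?thesis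
    unfolding st_le_def using assms by (simp add: compl)
qed

theorem theorem3p16:
  fixes n k d :: nat
    and A :: "real set"
    and T :: "real \<Rightarrow> (real \<Rightarrow> real) \<Rightarrow> (real \<Rightarrow> real)"
    and F \<psi> :: "real \<Rightarrow> real"
    and M :: "(nat \<Rightarrow> real) \<Rightarrow> 'a measure"
    and X :: "(nat \<Rightarrow> real) \<Rightarrow> nat \<Rightarrow> 'a \<Rightarrow> real"
  defines "Y \<equiv> \<lambda>\<alpha> \<omega>. order_stat n (n - k) (\<lambda>i. X \<alpha> i \<omega>)"
  assumes k: "1 \<le> k" "k \<le> n - 1"
    and T_maps: "\<And>\<alpha> G. \<alpha> \<in> A \<Longrightarrow> G \<in> cdfs \<Longrightarrow> T \<alpha> G \<in> cdfs"
    and T_diff: "\<And>G x. G \<in> cdfs \<Longrightarrow> (\<lambda>\<alpha>. T \<alpha> G x) differentiable_on A"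
    and F: "F \<in> cdfs"
    and d: "k + 3 \<le> d"
    and psi: "generator d \<psi>"
    and C_psi: "copula n (archimedean n \<psi>)"
    and phi_diff: "\<And>v. v \<in> relevant_interval A T F \<Longrightarrow>
          (\<lambda>u. enn2real (inverse_generator \<psi> u)) differentiable (at v)"
    and prob: "\<And>\<alpha>. \<alpha> \<in> {1..n} \<rightarrow>\<^sub>E A \<Longrightarrow> prob_space (M \<alpha>)"
    and rv: "\<And>\<alpha> i. \<alpha> \<in> {1..n} \<rightarrow>\<^sub>E A \<Longrightarrow> i \<in> {1..n} \<Longrightarrow> X \<alpha> i \<in> borel_measurable (M \<alpha>)"
    and marginals: "\<And>\<alpha> i. \<alpha> \<in> {1..n} \<rightarrow>\<^sub>E A \<Longrightarrow> i \<in> {1..n} \<Longrightarrow>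
          dist_fun (M \<alpha>) (X \<alpha> i) = T (\<alpha> i) F"
    and dependence: "\<And>\<alpha>. \<alpha> \<in> {1..n} \<rightarrow>\<^sub>E A \<Longrightarrow> has_copula (M \<alpha>) n (X \<alpha>) (archimedean n \<psi>)"
  shows "((\<forall>x. mono_on A (\<lambda>a. T a F x)) \<longrightarrow>
            (\<forall>x. increasing_each_coord n A (\<lambda>\<alpha>. dist_fun (M \<alpha>) (Y \<alpha>) x)))
       \<and> ((\<forall>x. antimono_on A (\<lambda>a. T a F x)) \<longrightarrow>
            (\<forall>x. decreasing_each_coord n A (\<lambda>\<alpha>. dist_fun (M \<alpha>) (Y \<alpha>) x)))
       \<and> (\<forall>\<alpha> \<in> {1..n} \<rightarrow>\<^sub>E A. \<forall>\<beta> \<in> {1..n} \<rightarrow>\<^sub>E A. (\<forall>i\<in>{1..n}. \<alpha> i \<le> \<beta> i) \<longrightarrow>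
            ((\<forall>x. mono_on A (\<lambda>a. T a F x)) \<longrightarrow> st_le (M \<beta>) (Y \<beta>) (M \<alpha>) (Y \<alpha>))
          \<and> ((\<forall>x. antimono_on A (\<lambda>a. T a F x)) \<longrightarrow> st_le (M \<alpha>) (Y \<alpha>) (M \<beta>) (Y \<beta>)))"
proof -
  \<comment> \<open>The bound \<open>1 \<le> k\<close> rules out \<open>n = 0\<close>, so the
    truncated subtraction in \<open>k \<le> n - 1\<close> does give \<open>k < n\<close>.\<close>
  have j: "1 \<le> n - k" "n - k \<le> n"
    using k by auto
  have Y: "Y \<alpha> \<in> borel_measurable (M \<alpha>)" if "\<alpha> \<in> {1..n} \<rightarrow>\<^sub>E A" for \<alpha>
    unfolding Y_def using that rv by (intro measurable_order_stat j) auto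
  \<comment> \<open>The parameters are compared only through the values of \<open>T\<close> at the
    one point \<open>x\<close>, with no order on \<alpha> and \<beta>. The same fact therefore
    serves the increasing and the decreasing case.\<close>
  have cmp: "dist_fun (M \<alpha>) (Y \<alpha>) x \<le> dist_fun (M \<beta>) (Y \<beta>) x"
    if "\<alpha> \<in> {1..n} \<rightarrow>\<^sub>E A" "\<beta> \<in> {1..n} \<rightarrow>\<^sub>E A" "\<And>i. i \<in> {1..n} \<Longrightarrow> T (\<alpha> i) F x \<le> T (\<beta> i) F x"
    for \<alpha> \<beta> x
    unfolding Y_def using that
    by (intro dist_fun_order_stat_mono[OF j C_psi] prob rv dependence) (simp_all add: marginals)
  \<comment> \<open>Updating at \<open>i\<close> gives a function on \<open>insert i {1..n}\<close>,
    which is \<open>{1..n}\<close> again because \<open>i\<close> already belongs to it.\<close>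
  have upd: "\<alpha>(i := t) \<in> {1..n} \<rightarrow>\<^sub>E A" if "\<alpha> \<in> {1..n} \<rightarrow>\<^sub>E A" "i \<in> {1..n}" "t \<in> A" for \<alpha> i t
    using that by (metis PiE_fun_upd insert_absorb)
  have "increasing_each_coord n A (\<lambda>\<alpha>. dist_fun (M \<alpha>) (Y \<alpha>) x)"
    if "\<forall>x. mono_on A (\<lambda>a. T a F x)" for x
    unfolding increasing_each_coord_def
    by (intro ballI mono_onI cmp upd) (use that in \<open>auto dest: mono_onD\<close>)
  moreover have "decreasing_each_coord n A (\<lambda>\<alpha>. dist_fun (M \<alpha>) (Y \<alpha>) x)"
    if "\<forall>x. antimono_on A (\<lambda>a. T a F x)" for x
    unfolding decreasing_each_coord_def
    by (intro ballI monotone_onI cmp upd) (use that in \<open>auto dest: monotone_onD\<close>)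
  moreover have "st_le (M \<beta>) (Y \<beta>) (M \<alpha>) (Y \<alpha>)"
    if "\<forall>x. mono_on A (\<lambda>a. T a F x)" "\<alpha> \<in> {1..n} \<rightarrow>\<^sub>E A" "\<beta> \<in> {1..n} \<rightarrow>\<^sub>E A" "\<forall>i\<in>{1..n}. \<alpha> i \<le> \<beta> i"
    for \<alpha> \<beta>
    by (intro st_le_of_dist_fun prob Y cmp that(2,3) mono_onD[OF that(1)[rule_format]])
      (use that in auto)
  moreover have "st_le (M \<alpha>) (Y \<alpha>) (M \<beta>) (Y \<beta>)"
    if "\<forall>x. antimono_on A (\<lambda>a. T a F x)" "\<alpha> \<in> {1..n} \<rightarrow>\<^sub>E A" "\<beta> \<in> {1..n} \<rightarrow>\<^sub>E A" "\<forall>i\<in>{1..n}. \<alpha> i \<le> \<beta> i"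
    for \<alpha> \<beta>
    by (intro st_le_of_dist_fun prob Y cmp that(2,3) monotone_onD[OF that(1)[rule_format]])
      (use that in auto)
  ultimately show ?thesis
    by blast
qed

end
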